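(* Let $A=(a_{nk})_{n,k\ge 0}$ and $B=(b_{nk})_{n,k\ge 0}$ be two probability matrices such that $\lim_{n} b_{n0}=0$. Assume that the pair $(A,B)$ satisfies property $( *\mathrm{C})$ and that the pair $(A,B\Delta)$ satisfies property $( *3\mathrm{C})$. If $E$ is a reflexive locally convex space, then every $A$-bounded operator on $E$ is $B$-ergodic.
   Context: All locally convex spaces are Hausdorff and over $\mathbb{C}$; an operator on $E$ is a continuous linear map $E\to E$. A reflexive space is a barrelled, semi-reflexive locally convex Hausdorff space. Matrices are infinite complex matrices indexed by $\mathbb{N}_0=\{0,1,2,\dots\}$; $A=(a_{nk})$ is lower triangular if $a_{nk}=0$ whenever $k>n$. A probability matrix is a lower triangular matrix with $a_{nk}\ge 0$ for all $n,k$ and $\sum_{i=0}^n a_{ni}=1$ for every $n$. For a lower triangular matrix $A$ and an operator $T$ on $E$ put $(AT)_n=\sum_{i=0}^n a_{ni}T^i$, with $T^0=\mathrm{Id}$. $T$ is $A$-bounded if for every continuous seminorm $p$ on $E$ there is a continuous seminorm $q$ on $E$ with $p((AT)_n x)\le q(x)$ for all $x\in E$, $n\in\mathbb{N}_0$. $T$ is $A$-ergodic if there is an operator $P$ on $E$ with $(AT)_n x\to Px$ for every $x\in E$. For lower triangular matrices $A,B$: the pair $(A,B)$ satisfies $( *\mathrm{C})$ if there is a lower triangular matrix $C=(c_{ni})$ with $CA=B$ and $\sup_n\sum_{i=0}^\infty|c_{ni}|<\infty$; it satisfies $( *3\mathrm{C})$ if there is a lower triangular $C$ with $CA=B$ and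 $\lim_n\sum_{i=0}^\infty|c_{ni}|=0$. $\Delta$ is the lower triangular matrix with entries $\Delta_{n,i}=\delta_{n,i}-\delta_{n-1,i}$ ($n,i\ge0$; $1$ on the diagonal, $-1$ just below it, $0$ elsewhere), and $B\Delta$ is the usual matrix product. *)

theory Defs
  imports "HOL-Analysis.Analysis"
begin

section \<open>Complex locally convex Hausdorff spaces\<close>

text \<open>
  The real scalar multiplication is a superclass operation, tied to the complex one by
  \<open>scaleR_scaleC\<close>. Continuity of addition and the Hausdorff property come from the
  superclasses. Local convexity and continuity of scalar multiplication are unfolded, since
  \<^const>\<open>convex\<close> and \<^const>\<open>continuous_on\<close> are not available inside the class
  specification; the lemmas \<open>locally_convex\<close> and \<open>continuous_on_scaleC\<close> restate them.
\<close>

class complex_lcs = real_vector + topological_ab_group_add + t2_space +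
  fixes scaleC :: "complex \<Rightarrow> 'a \<Rightarrow> 'a"  (infixr \<open>*\<^sub>C\<close> 75)
  assumes scaleC_add_right: "c *\<^sub>C (x + y) = c *\<^sub>C x + c *\<^sub>C y"
    and scaleC_add_left: "(c + d) *\<^sub>C x = c *\<^sub>C x + d *\<^sub>C x"
    and scaleC_scaleC: "c *\<^sub>C (d *\<^sub>C x) = (c * d) *\<^sub>C x"
    and scaleC_one: "1 *\<^sub>C x = x"
    and scaleR_scaleC: "r *\<^sub>R x = complex_of_real r *\<^sub>C x"
    and tendsto_scaleC_nhds:
      "LIM z (nhds c \<times>\<^sub>F nhds x). fst z *\<^sub>C snd z :> nhds (c *\<^sub>C x)"
    and locally_convex_raw: "open U \<Longrightarrow> 0 \<in> U \<Longrightarrow>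
      \<exists>V. open V \<and> 0 \<in> V \<and> V \<subseteq> U \<and>
        (\<forall>x\<in>V. \<forall>y\<in>V. \<forall>u\<ge>0. \<forall>v\<ge>0. u + v = 1 \<longrightarrow> u *\<^sub>R x + v *\<^sub>R y \<in> V)"

lemma locally_convex:
  fixes U :: "'a::complex_lcs set"
  assumes "open U" "0 \<in> U"
  shows "\<exists>V. open V \<and> 0 \<in> V \<and> V \<subseteq> U \<and> convex V"
  using locally_convex_raw[OF assms] unfolding convex_def by blast

lemma continuous_on_scaleC:
  "continuous_on UNIV (\<lambda>z :: complex \<times> 'a::complex_lcs. fst z *\<^sub>C snd z)"
proof -
  have "((\<lambda>z. fst z *\<^sub>C snd z) \<longlongrightarrow> fst w *\<^sub>C snd w) (nhds w)"
    for w :: "complex \<times> 'a"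
    using tendsto_scaleC_nhds[of "fst w" "snd w"] by (simp add: nhds_prod[symmetric])
  then show ?thesis
    unfolding continuous_on_def by (meson tendsto_mono at_within_le_nhds)
qed

lemma vector_space_scaleC: "vector_space (scaleC :: complex \<Rightarrow> 'a \<Rightarrow> 'a::complex_lcs)"
  by unfold_locales (simp_all add: scaleC_add_right scaleC_add_left scaleC_scaleC scaleC_one)

definition lcs_operator :: "('a::complex_lcs \<Rightarrow> 'a) \<Rightarrow> bool" where
  "lcs_operator T \<longleftrightarrow> Vector_Spaces.linear scaleC scaleC T \<and> continuous_on UNIV T"

definition cont_seminorm :: "('a::complex_lcs \<Rightarrow> real) \<Rightarrow> bool" where
  "cont_seminorm p \<longleftrightarrow>
     (\<forall>x. 0 \<le> p x) \<and> (\<forall>x y. p (x + y) \<le> p x + p y) \<and>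
     (\<forall>c x. p (c *\<^sub>C x) = cmod c * p x) \<and> continuous_on UNIV p"


section \<open>Reflexive spaces\<close>

definition absorbs :: "'a::complex_lcs set \<Rightarrow> 'a set \<Rightarrow> bool" where
  "absorbs U S \<longleftrightarrow> (\<exists>r>0. \<forall>c. cmod c \<ge> r \<longrightarrow> S \<subseteq> (\<lambda>x. c *\<^sub>C x) ` U)"

definition lcs_bounded :: "'a::complex_lcs set \<Rightarrow> bool" where
  "lcs_bounded S \<longleftrightarrow> (\<forall>U. open U \<and> 0 \<in> U \<longrightarrow> absorbs U S)"

definition balanced :: "'a::complex_lcs set \<Rightarrow> bool" where
  "balanced S \<longleftrightarrow> (\<forall>c. \<forall>x\<in>S. cmod c \<le> 1 \<longrightarrow> c *\<^sub>C x \<in> S)"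

definition barrel :: "'a::complex_lcs set \<Rightarrow> bool" where
  "barrel S \<longleftrightarrow> closed S \<and> convex S \<and> balanced S \<and> (\<forall>x. absorbs S {x})"

definition barrelled :: "'a::complex_lcs itself \<Rightarrow> bool" where
  "barrelled _ \<longleftrightarrow> (\<forall>S::'a set. barrel S \<longrightarrow> 0 \<in> interior S)"

definition dual_space :: "('a::complex_lcs \<Rightarrow> complex) set" where
  "dual_space = {f. Vector_Spaces.linear scaleC (*) f \<and> continuous_on UNIV f}"

text \<open>
  The strong topology on the dual is that of uniform convergence on the bounded subsets.
  The sets \<open>{g. \<forall>x\<in>S. cmod (g x - f x) < e}\<close> form a neighbourhood base at \<open>f\<close>, but need not
  themselves be open.
\<close>

definition strong_dual_topology :: "('a::complex_lcs \<Rightarrow> complex) topology" where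
  "strong_dual_topology = topology (\<lambda>W. W \<subseteq> dual_space \<and>
     (\<forall>f\<in>W. \<exists>S e. lcs_bounded S \<and> e > 0 \<and>
        {g \<in> dual_space. \<forall>x\<in>S. cmod (g x - f x) < e} \<subseteq> W))"

lemma lcs_bounded_Un:
  assumes "lcs_bounded S" "lcs_bounded S'"
  shows "lcs_bounded (S \<union> S')"
  unfolding lcs_bounded_def
proof (intro allI impI)
  fix U :: "'a set"
  assume U: "open U \<and> 0 \<in> U"
  obtain r where r: "r > 0" "\<forall>c. cmod c \<ge> r \<longrightarrow> S \<subseteq> (\<lambda>x. c *\<^sub>C x) ` U"
    using assms(1) U unfolding lcs_bounded_def absorbs_def by blast
  obtain r' where r': "r' > 0" "\<forall>c. cmod c \<ge> r' \<longrightarrow> S' \<subseteq> (\<lambda>x. c *\<^sub>C x) ` U"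
    using assms(2) U unfolding lcs_bounded_def absorbs_def by blast
  show "absorbs U (S \<union> S')"
    unfolding absorbs_def using r r' by (intro exI[of _ "max r r'"]) auto
qed

lemma openin_strong_dual_topology:
  "openin strong_dual_topology W \<longleftrightarrow> W \<subseteq> dual_space \<and>
     (\<forall>f\<in>W. \<exists>S e. lcs_bounded S \<and> e > 0 \<and>
        {g \<in> dual_space. \<forall>x\<in>S. cmod (g x - f x) < e} \<subseteq> W)"
proof -
  let ?nb = "\<lambda>W f. \<exists>S e. lcs_bounded S \<and> e > 0 \<and>
        {g \<in> dual_space. \<forall>x\<in>S. cmod (g x - f x) < e} \<subseteq> W"
  have inter: "?nb (V \<inter> W) f" if V: "?nb V f" and W: "?nb W f"
    for V W and f :: "'a \<Rightarrow> complex"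
  proof -
    obtain S e where 1: "lcs_bounded S" "e > 0"
        "{g \<in> dual_space. \<forall>x\<in>S. cmod (g x - f x) < e} \<subseteq> V"
      using V by blast
    obtain S' e' where 2: "lcs_bounded S'" "e' > 0"
        "{g \<in> dual_space. \<forall>x\<in>S'. cmod (g x - f x) < e'} \<subseteq> W"
      using W by blast
    have "{g \<in> dual_space. \<forall>x\<in>S \<union> S'. cmod (g x - f x) < min e e'} \<subseteq> V \<inter> W"
      using 1(3) 2(3) by auto
    moreover have "lcs_bounded (S \<union> S')" "min e e' > 0"
      using lcs_bounded_Un[OF 1(1) 2(1)] 1(2) 2(2) by simp_all
    ultimately show ?thesis by (intro exI[of _ "S \<union> S'"] exI[of _ "min e e'"] conjI)
  qed
  have union: "?nb (\<Union>\<W>) f" if "f \<in> W" and mem: "W \<in> \<W>" and nb: "?nb W f"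
    for \<W> W and f :: "'a \<Rightarrow> complex"
  proof -
    obtain S e where 1: "lcs_bounded S" "e > 0"
        "{g \<in> dual_space. \<forall>x\<in>S. cmod (g x - f x) < e} \<subseteq> W"
      using nb by blast
    have "{g \<in> dual_space. \<forall>x\<in>S. cmod (g x - f x) < e} \<subseteq> \<Union>\<W>"
      using 1(3) mem by (rule order_trans[OF _ Union_upper])
    then show ?thesis using 1(1,2) by (intro exI[of _ S] exI[of _ e] conjI)
  qed
  define L where "L = (\<lambda>W :: ('a \<Rightarrow> complex) set. W \<subseteq> dual_space \<and> (\<forall>f\<in>W. ?nb W f))"
  have LI: "L W" if "W \<subseteq> dual_space" "\<And>f. f \<in> W \<Longrightarrow> ?nb W f" for W
    unfolding L_def by (rule conjI[OF that(1) ballI[OF that(2)]])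
  have L1: "W \<subseteq> dual_space" if "L W" for W
    using that unfolding L_def by (rule conjunct1)
  have L2: "?nb W f" if "L W" "f \<in> W" for W f
    using that(1) unfolding L_def by (rule bspec[OF conjunct2 that(2)])
  have 1: "L (V \<inter> W)" if "L V" "L W" for V W
  proof (rule LI)
    show "V \<inter> W \<subseteq> dual_space" using L1[OF that(1)] by (rule le_infI1)
    show "?nb (V \<inter> W) f" if "f \<in> V \<inter> W" for f
      by (rule inter[OF L2[OF \<open>L V\<close> IntD1[OF that]] L2[OF \<open>L W\<close> IntD2[OF that]]])
  qed
  have 2: "L (\<Union>\<W>)" if L: "\<And>W. W \<in> \<W> \<Longrightarrow> L W" for \<W>
  proof (rule LI)
    show "\<Union>\<W> \<subseteq> dual_space" by (rule Union_least[OF L1[OF L]])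
    show "?nb (\<Union>\<W>) f" if "f \<in> \<Union>\<W>" for f
      using that by (rule UnionE) (rule union[OF _ _ L2[OF L]])
  qed
  have "istopology L"
    unfolding istopology_def using 1 2 by blast
  then have "openin (topology L) W \<longleftrightarrow> L W"
    by (simp only: topology_inverse')
  then show ?thesis
    unfolding strong_dual_topology_def L_def .
qed

text \<open>
  An element of the bidual is a function on \<open>'a \<Rightarrow> complex\<close> of which only the values on
  \<^term>\<open>dual_space\<close> matter.
\<close>

definition bidual_functional :: "(('a::complex_lcs \<Rightarrow> complex) \<Rightarrow> complex) \<Rightarrow> bool" where
  "bidual_functional \<phi> \<longleftrightarrow>
     (\<forall>f\<in>dual_space. \<forall>g\<in>dual_space. \<phi> (\<lambda>x. f x + g x) = \<phi> f + \<phi> g) \<and>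
     (\<forall>c. \<forall>f\<in>dual_space. \<phi> (\<lambda>x. c * f x) = c * \<phi> f) \<and>
     continuous_map strong_dual_topology euclidean \<phi>"

definition semi_reflexive :: "'a::complex_lcs itself \<Rightarrow> bool" where
  "semi_reflexive _ \<longleftrightarrow>
     (\<forall>\<phi>. bidual_functional \<phi> \<longrightarrow> (\<exists>x::'a. \<forall>f\<in>dual_space. \<phi> f = f x))"

definition reflexive_space :: "'a::complex_lcs itself \<Rightarrow> bool" where
  "reflexive_space E \<longleftrightarrow> barrelled E \<and> semi_reflexive E"


section \<open>Infinite matrices\<close>

type_synonym inf_matrix = "nat \<Rightarrow> nat \<Rightarrow> complex"

definition lower_triangular :: "inf_matrix \<Rightarrow> bool" where
  "lower_triangular A \<longleftrightarrow> (\<forall>n k. k > n \<longrightarrow> A n k = 0)"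

definition probability_matrix :: "inf_matrix \<Rightarrow> bool" where
  "probability_matrix A \<longleftrightarrow>
     lower_triangular A \<and> (\<forall>n k. A n k \<in> \<real>\<^sub>\<ge>\<^sub>0) \<and> (\<forall>n. (\<Sum>i\<le>n. A n i) = 1)"

text \<open>
  All products below have a lower triangular left factor, so that the series are finite sums;
  likewise for the row sums in \<open>star_C\<close> and \<open>star_3C\<close>.
\<close>

definition matrix_prod :: "inf_matrix \<Rightarrow> inf_matrix \<Rightarrow> inf_matrix" where
  "matrix_prod C A = (\<lambda>n k. \<Sum>i. C n i * A i k)"

definition Delta :: inf_matrix where
  "Delta = (\<lambda>n i. if i = n then 1 else if n = Suc i then -1 else 0)"

definition star_C :: "inf_matrix \<Rightarrow> inf_matrix \<Rightarrow> bool" where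
  "star_C A B \<longleftrightarrow> (\<exists>C. lower_triangular C \<and> matrix_prod C A = B \<and>
     bdd_above (range (\<lambda>n. \<Sum>i. cmod (C n i))))"

definition star_3C :: "inf_matrix \<Rightarrow> inf_matrix \<Rightarrow> bool" where
  "star_3C A B \<longleftrightarrow> (\<exists>C. lower_triangular C \<and> matrix_prod C A = B \<and>
     (\<lambda>n. \<Sum>i. cmod (C n i)) \<longlonglongrightarrow> 0)"


section \<open>Matrix means of an operator\<close>

definition matrix_mean :: "inf_matrix \<Rightarrow> ('a::complex_lcs \<Rightarrow> 'a) \<Rightarrow> nat \<Rightarrow> 'a \<Rightarrow> 'a" where
  "matrix_mean A T n x = (\<Sum>i\<le>n. A n i *\<^sub>C (T ^^ i) x)"

definition matrix_bounded :: "inf_matrix \<Rightarrow> ('a::complex_lcs \<Rightarrow> 'a) \<Rightarrow> bool" where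
  "matrix_bounded A T \<longleftrightarrow>
     (\<forall>p. cont_seminorm p \<longrightarrow> (\<exists>q. cont_seminorm q \<and> (\<forall>x n. p (matrix_mean A T n x) \<le> q x)))"

definition matrix_ergodic :: "inf_matrix \<Rightarrow> ('a::complex_lcs \<Rightarrow> 'a) \<Rightarrow> bool" where
  "matrix_ergodic A T \<longleftrightarrow> (\<exists>P. lcs_operator P \<and> (\<forall>x. (\<lambda>n. matrix_mean A T n x) \<longlonglongrightarrow> P x))"

end

theory Submission
  imports Defs
begin

text \<open>
  This is von Neumann's mean ergodic argument, carried by weak compactness. Write \<open>M\<^sub>n\<close> for the
  \<open>B\<close>-means of \<open>T\<close>. A factorisation \<open>CA = B\<close> expresses each \<open>M\<^sub>n x\<close> as a combination of the
  \<open>A\<close>-means of \<open>x\<close> with coefficients of bounded total modulus, so the \<open>A\<close>-boundedness of \<open>T\<close>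
  makes the operators \<open>M\<^sub>n\<close> equicontinuous (\<open>matrix_mean_prod_le\<close>). In the same way, a
  factorisation of \<open>B\<Delta>\<close> with vanishing row sums makes the \<open>B\<Delta>\<close>-means tend to zero. Summation by
  parts identifies \<open>T\<close> applied to the \<open>B\<Delta>\<close>-mean of \<open>x\<close> with \<open>T (M\<^sub>n x) - M\<^sub>n x + b\<^sub>n\<^sub>0 x\<close>
  (\<open>operator_matrix_mean_Delta\<close>), and as \<open>b\<^sub>n\<^sub>0\<close> tends to zero, the means are asymptotically
  invariant: \<open>T (M\<^sub>n x) - M\<^sub>n x\<close> tends to zero.

  In a semi-reflexive space these two facts yield convergence (\<open>mean_ergodic\<close>). The bounded sequence \<open>M\<^sub>n x\<close>
  has a weak cluster point \<open>y\<close> (\<open>semi_reflexive_weak_cluster_point\<close>), and asymptotic invariance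
  gives \<open>T y = y\<close>. A continuous functional that vanishes on the range of \<open>I - T\<close> takes the value
  \<open>f x\<close> at every \<open>M\<^sub>n x\<close>, hence also at \<open>y\<close>; by the Hahn--Banach theorem, \<open>x - y\<close> is therefore
  approximated by vectors \<open>w - T w\<close> (\<open>approximable_if_annihilated\<close>). On such vectors \<open>M\<^sub>n\<close> tends
  to zero, and equicontinuity carries this over to \<open>x - y\<close>. Since \<open>M\<^sub>n y = y\<close>, the means \<open>M\<^sub>n x\<close>
  converge to \<open>y\<close> in the original topology.

  The functional-analytic tools rest on two constructions: the Minkowski gauge, by which the
  continuous seminorms determine the topology, and a real Hahn--Banach theorem for sublinear
  functionals, obtained from the linearity of minimal sublinear functionals.
\<close>


section \<open>A Hahn--Banach theorem for sublinear functionals\<close>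

definition sublinear :: "('a::real_vector \<Rightarrow> real) \<Rightarrow> bool" where
  "sublinear q \<longleftrightarrow> (\<forall>x y. q (x + y) \<le> q x + q y) \<and> (\<forall>c\<ge>0. \<forall>x. q (c *\<^sub>R x) = c * q x)"

lemma sublinearI:
  fixes q :: "'a::real_vector \<Rightarrow> real"
  assumes zero: "q 0 = 0"
    and add: "\<And>x y. q (x + y) \<le> q x + q y"
    and scale: "\<And>c x. c > 0 \<Longrightarrow> q (c *\<^sub>R x) \<le> c * q x"
  shows "sublinear q"
proof -
  have "q (c *\<^sub>R x) = c * q x" if "c \<ge> 0" for c x
  proof (cases "c = 0")
    case False
    with that have c: "c > 0" by simp
    have "q ((1 / c) *\<^sub>R (c *\<^sub>R x)) \<le> (1 / c) * q (c *\<^sub>R x)"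
      by (rule scale) (use c in simp)
    then have "c * q x \<le> q (c *\<^sub>R x)"
      using c by (simp add: field_simps)
    with scale[OF c] show ?thesis by (rule order_antisym)
  qed (simp add: zero)
  with add show ?thesis
    unfolding sublinear_def by blast
qed

lemma sublinear_add: "sublinear q \<Longrightarrow> q (x + y) \<le> q x + q y"
  by (simp add: sublinear_def)

lemma sublinear_scale: "sublinear q \<Longrightarrow> c \<ge> 0 \<Longrightarrow> q (c *\<^sub>R x) = c * q x"
  by (simp add: sublinear_def)

lemma sublinear_zero: "sublinear q \<Longrightarrow> q 0 = 0"
  using sublinear_scale[of q 0 0] by simp

lemma sublinear_lower: "sublinear q \<Longrightarrow> - q (- x) \<le> q x"
  using sublinear_add[of q x "- x"] sublinear_zero[of q] by simp

lemma sublinear_linear: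
  fixes m :: "'a::real_vector \<Rightarrow> real"
  assumes m: "sublinear m" and neg: "\<And>y. m (- y) \<le> - m y"
  shows "linear m"
proof -
  have neg': "m (- y) = - m y" for y
    using neg[of y] sublinear_lower[OF m, of "- y"] by simp
  have scale: "m (c *\<^sub>R x) = c * m x" for c x
  proof (cases "c \<ge> 0")
    case False
    then have "m (c *\<^sub>R x) = - m ((- c) *\<^sub>R x)"
      using neg'[of "(- c) *\<^sub>R x"] by simp
    also have "m ((- c) *\<^sub>R x) = (- c) * m x"
      using False by (intro sublinear_scale[OF m]) simp
    finally show ?thesis by simp
  qed (simp add: sublinear_scale[OF m])
  have add: "m (x + y) = m x + m y" for x y
    using sublinear_add[OF m, of x y] sublinear_add[OF m, of "x + y" "- y"]
    by (simp add: neg')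
  show ?thesis
    by (rule linearI) (simp_all add: add scale)
qed

text \<open>
  If \<open>k \<le> q\<close> is sublinear with \<open>k (- y) \<le> - q y\<close>, then \<open>k x \<le> k (x + t y) + t k (- y)\<close> is at
  most \<open>q (x + t y) - t q y\<close> for every \<open>t \<ge> 0\<close>. The infimum of these bounds over \<open>t\<close> is itself
  such a functional. The lemma serves twice: it shows that a minimal sublinear functional is
  linear, and it lets the Hahn--Banach extension attain \<open>q\<close> at a prescribed point.
\<close>

lemma sublinear_decrease:
  fixes q :: "'a::real_vector \<Rightarrow> real"
  assumes q: "sublinear q"
  shows "\<exists>m. sublinear m \<and> (\<forall>x. m x \<le> q x) \<and> m (- y) \<le> - q y"
proof -
  define h where "h x t = q (x + t *\<^sub>R y) - t * q y" for x t
  define m where "m x = (INF t\<in>{0..}. h x t)" for x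
  have lower: "- q (- x) \<le> h x t" if "t \<ge> 0" for x t
    using sublinear_add[OF q, of "x + t *\<^sub>R y" "- x"] sublinear_scale[OF q that, of y]
    by (simp add: h_def)
  have bdd: "bdd_below (h x ` {0..})" for x
    using lower by (auto simp: bdd_below_def intro!: exI[of _ "- q (- x)"])
  have m_le: "m x \<le> h x t" if "t \<ge> 0" for x t
    unfolding m_def by (rule cINF_lower[OF bdd]) (use that in simp)
  have le_m: "a \<le> m x" if "\<And>t. t \<ge> 0 \<Longrightarrow> a \<le> h x t" for a x
    unfolding m_def by (rule cINF_greatest) (use that in auto)
  have below: "m x \<le> q x" for x
    using m_le[of 0 x] by (simp add: h_def)
  have add: "m (u + v) \<le> m u + m v" for u v
  proof -
    have "m (u + v) - h u s \<le> m v" if s: "s \<ge> 0" for s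
    proof (rule le_m)
      fix t :: real assume t: "t \<ge> 0"
      have "m (u + v) \<le> h (u + v) (s + t)"
        using s t by (intro m_le) simp
      also have "\<dots> \<le> h u s + h v t"
        using sublinear_add[OF q, of "u + s *\<^sub>R y" "v + t *\<^sub>R y"]
        by (simp add: h_def algebra_simps)
      finally show "m (u + v) - h u s \<le> h v t" by simp
    qed
    then have "m (u + v) - m v \<le> h u s" if "s \<ge> 0" for s
      using that by (simp add: algebra_simps)
    then have "m (u + v) - m v \<le> m u" by (rule le_m)
    then show ?thesis by simp
  qed
  have scale: "m (c *\<^sub>R x) \<le> c * m x" if c: "c > 0" for c x
  proof -
    have "m (c *\<^sub>R x) / c \<le> m x"
    proof (rule le_m)
      fix t :: real assume t: "t \<ge> 0"
      have "m (c *\<^sub>R x) \<le> h (c *\<^sub>R x) (c * t)"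
        using c t by (intro m_le) simp
      also have "\<dots> = c * h x t"
        using sublinear_scale[OF q, of c "x + t *\<^sub>R y"] c by (simp add: h_def algebra_simps)
      finally show "m (c *\<^sub>R x) / c \<le> h x t"
        using c by (simp add: field_simps)
    qed
    then show ?thesis using c by (simp add: field_simps)
  qed
  have "m 0 = 0"
  proof (rule order_antisym)
    show "m 0 \<le> 0" using below[of 0] sublinear_zero[OF q] by simp
    show "0 \<le> m 0" by (rule le_m) (use lower[of _ 0] sublinear_zero[OF q] in simp)
  qed
  moreover have "m (- y) \<le> - q y"
    using m_le[of 1 "- y"] sublinear_zero[OF q] by (simp add: h_def)
  ultimately show ?thesis
    using sublinearI[of m] add scale below by blast
qed

text \<open>
  Zorn's lemma applied to the sublinear functionals below \<open>q\<close>: a chain has its pointwise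
  infimum as a lower bound, which is finite because every member is at least
  \<open>\<lambda>x. - q (- x)\<close>.
\<close>

lemma minimal_sublinear:
  fixes q :: "'a::real_vector \<Rightarrow> real"
  assumes q: "sublinear q"
  shows "\<exists>m. sublinear m \<and> m \<le> q \<and> (\<forall>k. sublinear k \<longrightarrow> k \<le> m \<longrightarrow> k = m)"
proof -
  define A where "A = {m. sublinear m \<and> m \<le> q}"
  have "\<exists>m\<in>A. \<forall>a\<in>A. a \<le> m \<longrightarrow> a = m"
  proof (rule predicate_Zorn)
    show "partial_order_on A (relation_of (\<lambda>a b. b \<le> a) A)"
      by (rule partial_order_on_relation_ofI) auto
  next
    fix C assume C: "C \<in> Chains (relation_of (\<lambda>a b. b \<le> a) A)"
    then have CA: "m \<in> A" if "m \<in> C" for m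
      using that by (auto simp: Chains_def relation_of_def)
    have chain: "m \<le> k \<or> k \<le> m" if "m \<in> C" "k \<in> C" for m k
      using that C by (auto simp: Chains_def relation_of_def)
    show "\<exists>u\<in>A. \<forall>a\<in>C. u \<le> a"
    proof (cases "C = {}")
      case True
      then show ?thesis using q by (auto simp: A_def)
    next
      case False
      define u where "u x = (INF m\<in>C. m x)" for x
      have sub: "sublinear m" and le_q: "m x \<le> q x" if "m \<in> C" for m x
        using CA[OF that] by (auto simp: A_def le_fun_def)
      have bdd: "bdd_below ((\<lambda>m. m x) ` C)" for x
      proof -
        have "- q (- x) \<le> m x" if "m \<in> C" for m
          using le_q[OF that, of "- x"] sublinear_lower[OF sub[OF that], of x] by simp
        then show ?thesis by (auto simp: bdd_below_def)
      qed
      have u_le: "u x \<le> m x" if "m \<in> C" for m x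
        unfolding u_def by (rule cINF_lower[OF bdd that])
      have le_u: "a \<le> u x" if "\<And>m. m \<in> C \<Longrightarrow> a \<le> m x" for a x
        unfolding u_def by (rule cINF_greatest[OF False]) (use that in auto)
      have "sublinear u"
      proof (rule sublinearI)
        show "u 0 = 0"
        proof (rule order_antisym)
          obtain m where "m \<in> C" using False by blast
          then show "u 0 \<le> 0" using u_le[of m 0] sublinear_zero[OF sub, of m] by simp
          show "0 \<le> u 0" by (rule le_u) (simp add: sublinear_zero[OF sub])
        qed
        show "u (x + y) \<le> u x + u y" for x y
        proof -
          have "u (x + y) - m x \<le> k y" if "m \<in> C" "k \<in> C" for m k
          proof -
            \<comment> \<open>the smaller of the two functionals of the chain bounds both summands\<close>
            obtain l where "l \<in> C" "l \<le> m" "l \<le> k"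
              using chain[OF \<open>m \<in> C\<close> \<open>k \<in> C\<close>] \<open>m \<in> C\<close> \<open>k \<in> C\<close> by blast
            then have "u (x + y) \<le> l x + l y" "l x \<le> m x" "l y \<le> k y"
              using u_le[of l "x + y"] sublinear_add[OF sub[of l], of x y]
              by (auto simp: le_fun_def)
            then show ?thesis by linarith
          qed
          then have "u (x + y) - m x \<le> u y" if "m \<in> C" for m
            using that by (intro le_u) auto
          then have "u (x + y) - u y \<le> u x"
            by (intro le_u) (auto simp: algebra_simps)
          then show ?thesis by simp
        qed
        show "u (c *\<^sub>R x) \<le> c * u x" if c: "c > 0" for c x
        proof -
          have "u (c *\<^sub>R x) / c \<le> u x"
          proof (rule le_u)
            fix m assume m: "m \<in> C"
            have "u (c *\<^sub>R x) \<le> c * m x"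
              using u_le[OF m, of "c *\<^sub>R x"] sublinear_scale[OF sub[OF m], of c x] c by simp
            then show "u (c *\<^sub>R x) / c \<le> m x" using c by (simp add: field_simps)
          qed
          then show ?thesis using c by (simp add: field_simps)
        qed
      qed
      moreover have "u \<le> q"
      proof (rule le_funI)
        fix x
        obtain m where "m \<in> C" using False by blast
        then show "u x \<le> q x" using u_le[of m x] le_q[of m x] by simp
      qed
      ultimately show ?thesis
        using u_le by (auto simp: A_def le_fun_def)
    qed
  qed
  then obtain m where m: "sublinear m" "m \<le> q" and min: "\<And>a. a \<in> A \<Longrightarrow> a \<le> m \<Longrightarrow> a = m"
    by (auto simp: A_def)
  have "k = m" if "sublinear k" "k \<le> m" for k
    by (rule min) (use that m(2) order_trans[of k m q] in \<open>auto simp: A_def\<close>)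
  with m show ?thesis by blast
qed

text \<open>
  A minimal sublinear functional cannot be decreased at any \<open>- y\<close>, so it is linear. Decreasing \<open>q\<close>
  at \<open>- z\<close> beforehand forces every linear functional below the result to take the value \<open>q z\<close>
  at \<open>z\<close>.
\<close>

theorem Hahn_Banach_sublinear:
  fixes q :: "'a::real_vector \<Rightarrow> real"
  assumes q: "sublinear q"
  shows "\<exists>g. linear g \<and> (\<forall>x. g x \<le> q x) \<and> g z = q z"
proof -
  obtain q' where q': "sublinear q'" "\<And>x. q' x \<le> q x" "q' (- z) \<le> - q z"
    using sublinear_decrease[OF q, of z] by blast
  obtain g where g: "sublinear g" "g \<le> q'"
      and min: "\<And>k. sublinear k \<Longrightarrow> k \<le> g \<Longrightarrow> k = g"
    using minimal_sublinear[OF q'(1)] by blast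
  have "g (- y) \<le> - g y" for y
  proof -
    obtain k where k: "sublinear k" "\<And>x. k x \<le> g x" "k (- y) \<le> - g y"
      using sublinear_decrease[OF g(1), of y] by blast
    then have "k = g" by (intro min) (auto simp: le_fun_def)
    with k(3) show ?thesis by simp
  qed
  then have lin: "linear g" by (rule sublinear_linear[OF g(1)])
  have below: "g x \<le> q' x" for x
    using g(2) by (simp add: le_fun_def)
  then have "g x \<le> q x" for x
    using q'(2)[of x] order_trans by blast
  moreover have "q z \<le> g z"
    using below[of "- z"] q'(3) linear_neg[OF lin, of z] by simp
  ultimately show ?thesis
    using lin by (intro exI[of _ g]) (auto intro: order_antisym)
qed


section \<open>Continuous seminorms\<close>

interpretation cvs: vector_space "scaleC :: complex \<Rightarrow> 'a \<Rightarrow> 'a::complex_lcs"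
  by (rule vector_space_scaleC)

lemma tendsto_scaleC:
  fixes g :: "'b \<Rightarrow> 'a::complex_lcs"
  assumes "(f \<longlongrightarrow> c) F" and "(g \<longlongrightarrow> x) F"
  shows "((\<lambda>t. f t *\<^sub>C g t) \<longlongrightarrow> c *\<^sub>C x) F"
  using filterlim_compose[OF tendsto_scaleC_nhds filterlim_Pair[OF assms]] by simp

lemma continuous_on_UNIV_tendsto:
  "continuous_on UNIV f \<Longrightarrow> (g \<longlongrightarrow> x) F \<Longrightarrow> ((\<lambda>t. f (g t)) \<longlongrightarrow> f x) F"
  by (rule continuous_on_tendsto_compose[of UNIV]) simp_all

lemma
  assumes "cont_seminorm p"
  shows cont_seminorm_nonneg: "0 \<le> p x"
    and cont_seminorm_add: "p (x + y) \<le> p x + p y"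
    and cont_seminorm_scale: "p (c *\<^sub>C x) = cmod c * p x"
    and cont_seminorm_continuous: "continuous_on UNIV p"
  using assms by (auto simp: cont_seminorm_def)

lemma cont_seminorm_zero: "cont_seminorm p \<Longrightarrow> p 0 = 0"
  using cont_seminorm_scale[of p 0 0] by simp

lemma cont_seminorm_minus: "cont_seminorm p \<Longrightarrow> p (- x) = p x"
  using cont_seminorm_scale[of p "- 1" x] by simp

lemma cont_seminorm_diff: "cont_seminorm p \<Longrightarrow> p (x - y) \<le> p x + p y"
  using cont_seminorm_add[of p x "- y"] by (simp add: cont_seminorm_minus)

lemma cont_seminorm_mult:
  assumes p: "cont_seminorm p" and K: "0 \<le> K"
  shows "cont_seminorm (\<lambda>x. K * p x)"
  unfolding cont_seminorm_def
proof (intro conjI allI)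
  fix x y c
  show "0 \<le> K * p x"
    using K cont_seminorm_nonneg[OF p] by simp
  show "K * p (x + y) \<le> K * p x + K * p y"
    using mult_left_mono[OF cont_seminorm_add[OF p] K] by (simp add: distrib_left)
  show "K * p (c *\<^sub>C x) = cmod c * (K * p x)"
    by (simp add: cont_seminorm_scale[OF p])
  show "continuous_on UNIV (\<lambda>x. K * p x)"
    by (intro continuous_on_mult_left cont_seminorm_continuous[OF p])
qed

lemma cont_seminorm_sum:
  assumes p: "cont_seminorm p"
  shows "p (\<Sum>i\<in>I. f i) \<le> (\<Sum>i\<in>I. p (f i))"
proof (induction I rule: infinite_finite_induct)
  case (insert i I)
  then show ?case using cont_seminorm_add[OF p, of "f i" "sum f I"] by simp
qed (simp_all add: cont_seminorm_zero[OF p])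

lemma cont_seminormI:
  fixes p :: "'a::complex_lcs \<Rightarrow> real"
  assumes nonneg: "\<And>x. 0 \<le> p x"
    and add: "\<And>x y. p (x + y) \<le> p x + p y"
    and scale: "\<And>c x. c \<noteq> 0 \<Longrightarrow> p (c *\<^sub>C x) \<le> cmod c * p x"
    and lim: "(p \<longlongrightarrow> 0) (nhds 0)"
  shows "cont_seminorm p"
proof -
  have zero: "p 0 = 0"
  proof -
    have "p 0 \<le> cmod (1 / 2) * p 0"
      using scale[of "1 / 2" 0] by simp
    with nonneg[of 0] show ?thesis by simp
  qed
  have "p (c *\<^sub>C x) = cmod c * p x" for c x
  proof (cases "c = 0")
    case False
    have "p ((1 / c) *\<^sub>C (c *\<^sub>C x)) \<le> cmod (1 / c) * p (c *\<^sub>C x)"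
      by (rule scale) (use False in simp)
    then have "cmod c * p x \<le> p (c *\<^sub>C x)"
      using False by (simp add: norm_divide field_simps)
    with scale[OF False] show ?thesis by (rule order_antisym)
  qed (simp add: zero)
  moreover have "continuous_on UNIV p"
  proof (clarsimp simp: continuous_on_eq_continuous_at isCont_def tendsto_at_iff_tendsto_nhds)
    fix x
    have minus: "p (- y) = p y" for y
      using \<open>p ((- 1) *\<^sub>C y) = cmod (- 1) * p y\<close> by simp
    have diff: "((\<lambda>y. p (y - x)) \<longlongrightarrow> 0) (nhds x)"
    proof (rule filterlim_compose[OF lim])
      have "((\<lambda>y. y - x) \<longlongrightarrow> x - x) (nhds x)"
        by (intro tendsto_diff tendsto_const filterlim_ident)
      then show "((\<lambda>y. y - x) \<longlongrightarrow> 0) (nhds x)" by simp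
    qed
    have "\<bar>p y - p x\<bar> \<le> p (y - x)" for y
      using add[of "y - x" x] add[of "x - y" y] minus[of "y - x"] by simp
    then have "((\<lambda>y. p y - p x) \<longlongrightarrow> 0) (nhds x)"
      by (intro Lim_null_comparison[OF _ diff] always_eventually) simp
    then show "(p \<longlongrightarrow> p x) (nhds x)"
      by (simp add: LIM_zero_iff)
  qed
  ultimately show ?thesis
    using nonneg add by (simp add: cont_seminorm_def)
qed

text \<open>
  The largest balanced subset of a convex neighbourhood of zero is still convex, and it is still
  a neighbourhood of zero because scalar multiplication is jointly continuous at \<open>(0, 0)\<close>.
\<close>

lemma convex_balanced_neighbourhood:
  fixes U :: "'a::complex_lcs set"
  assumes "open U" "0 \<in> U"
  shows "\<exists>W. W \<subseteq> U \<and> convex W \<and> balanced W \<and> eventually (\<lambda>x. x \<in> W) (nhds 0)"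
proof -
  obtain V where V: "open V" "0 \<in> V" "V \<subseteq> U" "convex V"
    using locally_convex[OF assms] by blast
  define W where "W = {x. \<forall>c. cmod c \<le> 1 \<longrightarrow> c *\<^sub>C x \<in> V}"
  have "W \<subseteq> U"
  proof
    fix x assume "x \<in> W"
    then have "1 *\<^sub>C x \<in> V" unfolding W_def by (auto simp del: cvs.scale_one)
    with V(3) show "x \<in> U" by auto
  qed
  moreover have "convex W"
  proof (rule convexI)
    fix x y :: 'a and u v :: real
    assume xy: "x \<in> W" "y \<in> W" and uv: "0 \<le> u" "0 \<le> v" "u + v = 1"
    have "c *\<^sub>C (u *\<^sub>R x + v *\<^sub>R y) \<in> V" if "cmod c \<le> 1" for c
    proof -
      have "u *\<^sub>R (c *\<^sub>C x) + v *\<^sub>R (c *\<^sub>C y) \<in> V"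
        using xy that by (intro convexD[OF V(4) _ _ uv]) (auto simp: W_def)
      then show ?thesis
        by (simp add: scaleR_scaleC scaleC_add_right mult.commute)
    qed
    then show "u *\<^sub>R x + v *\<^sub>R y \<in> W" by (simp add: W_def)
  qed
  moreover have "balanced W"
    unfolding balanced_def
  proof (intro allI ballI impI)
    fix c x assume x: "x \<in> W" and c: "cmod c \<le> 1"
    have "d *\<^sub>C (c *\<^sub>C x) \<in> V" if "cmod d \<le> 1" for d
    proof -
      have "cmod (d * c) \<le> 1" using that c by (simp add: norm_mult mult_le_one)
      with x show ?thesis by (simp add: W_def)
    qed
    then show "c *\<^sub>C x \<in> W" by (simp add: W_def)
  qed
  moreover have "eventually (\<lambda>x. x \<in> W) (nhds 0)"
  proof -
    have "eventually (\<lambda>z. fst z *\<^sub>C snd z \<in> V) (nhds (0::complex) \<times>\<^sub>F nhds (0::'a))"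
      using tendsto_scaleC_nhds[of 0 "0::'a"] V(1,2)
      by (auto simp: filterlim_iff eventually_nhds)
    then obtain P Q where P: "eventually P (nhds (0::complex))" and Q: "eventually Q (nhds (0::'a))"
        and PQ: "\<And>c x. P c \<Longrightarrow> Q x \<Longrightarrow> c *\<^sub>C x \<in> V"
      unfolding eventually_prod_filter by auto
    obtain d where d: "d > 0" "\<And>c. cmod c < d \<Longrightarrow> P c"
      using P unfolding eventually_nhds_metric by (auto simp: dist_norm)
    have "((\<lambda>x. complex_of_real (2 / d) *\<^sub>C x) \<longlongrightarrow> complex_of_real (2 / d) *\<^sub>C 0) (nhds (0::'a))"
      by (intro tendsto_scaleC tendsto_const filterlim_ident)
    then have "eventually (\<lambda>x. Q (complex_of_real (2 / d) *\<^sub>C x)) (nhds 0)"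
      using Q by (simp add: filterlim_iff)
    then show ?thesis
    proof (rule eventually_mono)
      fix x assume Qx: "Q (complex_of_real (2 / d) *\<^sub>C x)"
      have "c *\<^sub>C x \<in> V" if "cmod c \<le> 1" for c
      proof -
        \<comment> \<open>the factor \<open>d / 2\<close> brings the coefficients of the closed unit disc below \<open>d\<close>\<close>
        have "(c * complex_of_real (d / 2)) *\<^sub>C (complex_of_real (2 / d) *\<^sub>C x) \<in> V"
        proof (rule PQ[OF d(2) Qx])
          have "cmod c * (d / 2) \<le> 1 * (d / 2)"
            using that d(1) by (intro mult_right_mono) auto
          with d(1) show "cmod (c * complex_of_real (d / 2)) < d" by (simp add: norm_mult)
        qed
        with d(1) show ?thesis by simp
      qed
      then show "x \<in> W" by (simp add: W_def)
    qed
  qed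
  ultimately show ?thesis by blast
qed

text \<open>
  Continuous seminorms determine the topology: the Minkowski gauge of a convex balanced
  neighbourhood \<open>W\<close> is a seminorm whose open unit ball lies in \<open>W\<close>.
\<close>

lemma cont_seminorm_ball_subset:
  fixes U :: "'a::complex_lcs set"
  assumes "open U" "0 \<in> U"
  shows "\<exists>p. cont_seminorm p \<and> (\<forall>x. p x < 1 \<longrightarrow> x \<in> U)"
proof -
  obtain W where W: "W \<subseteq> U" "convex W" "balanced W"
      and ev: "eventually (\<lambda>x. x \<in> W) (nhds (0::'a))"
    using convex_balanced_neighbourhood[OF assms] by blast
  define G where "G x = {t::real. t > 0 \<and> (1 / t) *\<^sub>R x \<in> W}" for x
  define p where "p x = Inf (G x)" for x
  have evc: "eventually (\<lambda>t. f t \<in> W) F" if "(f \<longlongrightarrow> 0) F" for f and F :: "'b filter"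
    by (rule eventually_compose_filterlim[OF ev that])
  have ne: "G x \<noteq> {}" for x
  proof -
    have "((\<lambda>t. complex_of_real (1 / t) *\<^sub>C x) \<longlongrightarrow> complex_of_real 0 *\<^sub>C x) at_top"
      by (intro tendsto_scaleC tendsto_of_real tendsto_const) real_asymp
    then have "eventually (\<lambda>t. complex_of_real (1 / t) *\<^sub>C x \<in> W) at_top"
      by (intro evc) simp
    with eventually_gt_at_top[of 0] have "eventually (\<lambda>t. t \<in> G x) at_top"
      by eventually_elim (simp add: G_def scaleR_scaleC)
    then show ?thesis by (auto dest: eventually_happens)
  qed
  have bdd: "bdd_below (G x)" for x
    by (auto simp: G_def bdd_below_def intro!: exI[of _ 0])
  have p_le: "p x \<le> t" if "t \<in> G x" for x t
    unfolding p_def by (rule cInf_lower[OF that bdd])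
  have le_p: "a \<le> p x" if "\<And>t. t \<in> G x \<Longrightarrow> a \<le> t" for a x
    unfolding p_def by (rule cInf_greatest[OF ne that])
  have nonneg: "0 \<le> p x" for x
    by (rule le_p) (simp add: G_def)
  have "cont_seminorm p"
  proof (rule cont_seminormI)
    show "0 \<le> p x" for x by (rule nonneg)
    show "p (x + y) \<le> p x + p y" for x y
    proof -
      have "s + t \<in> G (x + y)" if s: "s \<in> G x" and t: "t \<in> G y" for s t
      proof -
        have st: "s > 0" "t > 0" using s t by (auto simp: G_def)
        have "(s / (s + t)) *\<^sub>R ((1 / s) *\<^sub>R x) + (t / (s + t)) *\<^sub>R ((1 / t) *\<^sub>R y) \<in> W"
          using s t by (intro convexD[OF W(2)]) (auto simp: G_def add_divide_distrib[symmetric])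
        then have "(1 / (s + t)) *\<^sub>R (x + y) \<in> W"
          using st by (simp add: scaleR_add_right)
        with st show ?thesis by (simp add: G_def)
      qed
      then have "p (x + y) - s \<le> t" if "s \<in> G x" "t \<in> G y" for s t
        using p_le[of "s + t" "x + y"] that by force
      then have "p (x + y) - s \<le> p y" if "s \<in> G x" for s
        using that by (intro le_p) auto
      then have "p (x + y) - p y \<le> p x"
        by (intro le_p) (auto simp: algebra_simps)
      then show ?thesis by simp
    qed
    show "p (c *\<^sub>C x) \<le> cmod c * p x" if c: "c \<noteq> 0" for c x
    proof -
      have "p (c *\<^sub>C x) / cmod c \<le> p x"
      proof (rule le_p)
        fix t assume t: "t \<in> G x"
        \<comment> \<open>a rotation keeps \<open>x / t\<close> inside \<open>W\<close>\<close>
        have "(c / complex_of_real (cmod c)) *\<^sub>C ((1 / t) *\<^sub>R x) \<in> W"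
          using t c W(3) by (auto simp: G_def balanced_def norm_divide)
        then have "cmod c * t \<in> G (c *\<^sub>C x)"
          using t c by (simp add: G_def scaleR_scaleC field_simps)
        then show "p (c *\<^sub>C x) / cmod c \<le> t"
          using p_le[of "cmod c * t" "c *\<^sub>C x"] c by (simp add: field_simps)
      qed
      then show ?thesis using c by (simp add: field_simps)
    qed
    show "(p \<longlongrightarrow> 0) (nhds 0)"
    proof (rule tendstoI)
      fix e :: real assume e: "e > 0"
      have "((\<lambda>x. complex_of_real (2 / e) *\<^sub>C x) \<longlongrightarrow> complex_of_real (2 / e) *\<^sub>C 0) (nhds (0::'a))"
        by (intro tendsto_scaleC tendsto_const filterlim_ident)
      then have "eventually (\<lambda>x. complex_of_real (2 / e) *\<^sub>C x \<in> W) (nhds (0::'a))"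
        by (intro evc) simp
      then show "eventually (\<lambda>x. dist (p x) 0 < e) (nhds 0)"
      proof (rule eventually_mono)
        fix x assume "complex_of_real (2 / e) *\<^sub>C x \<in> W"
        then have "e / 2 \<in> G x" using e by (simp add: G_def scaleR_scaleC)
        then have "p x \<le> e / 2" by (rule p_le)
        with e nonneg[of x] show "dist (p x) 0 < e" by simp
      qed
    qed
  qed
  moreover have "x \<in> U" if "p x < 1" for x
  proof -
    obtain t where t: "t \<in> G x" "t < 1"
      using \<open>p x < 1\<close> cInf_less_iff[OF ne bdd, of x 1] unfolding p_def by blast
    then have "complex_of_real t *\<^sub>C ((1 / t) *\<^sub>R x) \<in> W"
      using W(3) by (auto simp: G_def balanced_def)
    then have "x \<in> W" using t by (simp add: G_def scaleR_scaleC)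
    with W(1) show ?thesis by blast
  qed
  ultimately show ?thesis by blast
qed

lemma tendsto_iff_cont_seminorm:
  fixes f :: "'b \<Rightarrow> 'a::complex_lcs"
  shows "(f \<longlongrightarrow> l) F \<longleftrightarrow> (\<forall>p. cont_seminorm p \<longrightarrow> ((\<lambda>t. p (f t - l)) \<longlongrightarrow> 0) F)"
proof (intro iffI allI impI)
  fix p :: "'a \<Rightarrow> real"
  assume p: "cont_seminorm p" and lim: "(f \<longlongrightarrow> l) F"
  have "((\<lambda>t. p (f t - l)) \<longlongrightarrow> p (l - l)) F"
    by (intro continuous_on_UNIV_tendsto[OF cont_seminorm_continuous[OF p]] tendsto_diff lim
        tendsto_const)
  then show "((\<lambda>t. p (f t - l)) \<longlongrightarrow> 0) F"
    by (simp add: cont_seminorm_zero[OF p])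
next
  assume lim: "\<forall>p. cont_seminorm p \<longrightarrow> ((\<lambda>t. p (f t - l)) \<longlongrightarrow> 0) F"
  show "(f \<longlongrightarrow> l) F"
  proof (rule topological_tendstoI)
    fix S assume S: "open S" "l \<in> S"
    have "open ((\<lambda>x. x + l) -` S)"
      using S(1) by (intro open_vimage continuous_intros)
    then obtain p where p: "cont_seminorm p" "\<And>x. p x < 1 \<Longrightarrow> x + l \<in> S"
      using cont_seminorm_ball_subset[of "(\<lambda>x. x + l) -` S"] S(2) by auto
    have "eventually (\<lambda>t. p (f t - l) < 1) F"
      using lim p(1) by (auto intro: order_tendstoD)
    then show "eventually (\<lambda>t. f t \<in> S) F"
      by (rule eventually_mono) (use p(2) in force)
  qed
qed

lemma eq_zero_if_cont_seminorms_zero: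
  fixes z :: "'a::complex_lcs"
  assumes "\<And>p. cont_seminorm p \<Longrightarrow> p z = 0"
  shows "z = 0"
proof (rule ccontr)
  assume "z \<noteq> 0"
  then obtain U where "open U" "0 \<in> U" "z \<notin> U"
    using t1_space[of 0 z] by blast
  with cont_seminorm_ball_subset[of U] assms show False by fastforce
qed


section \<open>Separation by continuous linear functionals\<close>

lemma dual_space_iff:
  "f \<in> dual_space \<longleftrightarrow> (\<forall>x y. f (x + y) = f x + f y) \<and> (\<forall>c x. f (c *\<^sub>C x) = c * f x) \<and>
     continuous_on UNIV f"
  unfolding dual_space_def Vector_Spaces.linear_iff
  using vector_space_scaleC by (auto simp: vector_space_def algebra_simps)

lemma
  assumes "f \<in> dual_space"
  shows dual_add: "f (x + y) = f x + f y"
    and dual_scale: "f (c *\<^sub>C x) = c * f x"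
    and dual_continuous: "continuous_on UNIV f"
  using assms by (auto simp: dual_space_iff)

lemma dual_zero: "f \<in> dual_space \<Longrightarrow> f 0 = 0"
  using dual_scale[of f 0 0] by simp

lemma dual_diff: "f \<in> dual_space \<Longrightarrow> f (x - y) = f x - f y"
  using dual_add[of f "x - y" y] by simp

lemma dual_sum: "f \<in> dual_space \<Longrightarrow> f (\<Sum>i\<in>I. g i) = (\<Sum>i\<in>I. f (g i))"
  by (induction I rule: infinite_finite_induct) (simp_all add: dual_zero dual_add)

lemma cont_seminorm_dual:
  assumes f: "f \<in> dual_space"
  shows "cont_seminorm (\<lambda>x. cmod (f x))"
  unfolding cont_seminorm_def
  by (auto simp: dual_add[OF f] dual_scale[OF f] norm_triangle_ineq norm_mult
      intro!: continuous_on_norm dual_continuous[OF f])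

text \<open>
  The annihilator test for approximation by a subspace \<open>R\<close>. The distance
  \<open>\<lambda>x. INF r\<in>R. p (x - r)\<close> to \<open>R\<close> is sublinear and vanishes on \<open>R\<close>, so a real functional
  that it dominates vanishes on \<open>R\<close> too, and the complex functional with that real part is
  continuous because \<open>p\<close> dominates it.
\<close>

theorem approximable_if_annihilated:
  fixes R :: "'a::complex_lcs set"
  assumes R: "cvs.subspace R" and p: "cont_seminorm p" and e: "e > 0"
    and ann: "\<And>f. f \<in> dual_space \<Longrightarrow> (\<And>r. r \<in> R \<Longrightarrow> f r = 0) \<Longrightarrow> f z = 0"
  shows "\<exists>r\<in>R. p (z - r) < e"
proof (rule ccontr)
  assume "\<not> (\<exists>r\<in>R. p (z - r) < e)"
  then have far: "e \<le> p (z - r)" if "r \<in> R" for r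
    using that by force
  define q where "q x = (INF r\<in>R. p (x - r))" for x
  have R0: "0 \<in> R" by (rule cvs.subspace_0[OF R])
  have bdd: "bdd_below ((\<lambda>r. p (x - r)) ` R)" for x
    by (auto simp: bdd_below_def intro!: exI[of _ 0] cont_seminorm_nonneg[OF p])
  have q_le: "q x \<le> p (x - r)" if "r \<in> R" for x r
    unfolding q_def by (rule cINF_lower[OF bdd that])
  have le_q: "a \<le> q x" if "\<And>r. r \<in> R \<Longrightarrow> a \<le> p (x - r)" for a x
    unfolding q_def by (rule cINF_greatest) (use R0 that in auto)
  have q_p: "q x \<le> p x" for x
    using q_le[OF R0, of x] by simp
  have "sublinear q"
  proof (rule sublinearI)
    show "q 0 = 0"
      using q_p[of 0] le_q[of 0 0] cont_seminorm_nonneg[OF p] cont_seminorm_zero[OF p]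
      by (intro order_antisym) auto
    show "q (x + y) \<le> q x + q y" for x y
    proof -
      have "q (x + y) \<le> p (x - r) + p (y - s)" if "r \<in> R" "s \<in> R" for r s
        using q_le[OF cvs.subspace_add[OF R that], of "x + y"]
          cont_seminorm_add[OF p, of "x - r" "y - s"] by (simp add: algebra_simps)
      then have "q (x + y) - p (x - r) \<le> q y" if "r \<in> R" for r
        using that by (intro le_q) (auto simp: algebra_simps)
      then have "q (x + y) - q y \<le> q x"
        by (intro le_q) (auto simp: algebra_simps)
      then show ?thesis by simp
    qed
    show "q (c *\<^sub>R x) \<le> c * q x" if c: "c > 0" for c x
    proof -
      have "q (c *\<^sub>R x) / c \<le> q x"
      proof (rule le_q)
        fix r assume "r \<in> R"
        then have "q (c *\<^sub>R x) \<le> p (c *\<^sub>R x - complex_of_real c *\<^sub>C r)"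
          by (intro q_le cvs.subspace_scale[OF R])
        also have "\<dots> = p (complex_of_real c *\<^sub>C (x - r))"
          by (simp add: scaleR_scaleC cvs.scale_right_diff_distrib)
        also have "\<dots> = c * p (x - r)"
          using c by (simp add: cont_seminorm_scale[OF p])
        finally show "q (c *\<^sub>R x) / c \<le> p (x - r)"
          using c by (simp add: field_simps)
      qed
      then show ?thesis using c by (simp add: field_simps)
    qed
  qed
  then obtain g where g: "linear g" "\<And>x. g x \<le> q x" "g z = q z"
    using Hahn_Banach_sublinear[of q z] by blast
  have g_p: "\<bar>g x\<bar> \<le> p x" for x
    using g(2)[of x] g(2)[of "- x"] q_p[of x] q_p[of "- x"]
    by (simp add: linear_neg[OF g(1)] cont_seminorm_minus[OF p])
  have g_R: "g r = 0" if "r \<in> R" for r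
  proof -
    have "q s \<le> 0" if "s \<in> R" for s
      using q_le[OF that, of s] by (simp add: cont_seminorm_zero[OF p])
    then have "g r \<le> 0" "g (- r) \<le> 0"
      using g(2) that cvs.subspace_neg[OF R that] order_trans by blast+
    then show ?thesis by (simp add: linear_neg[OF g(1)])
  qed
  \<comment> \<open>the complex linear functional with real part \<open>g\<close>\<close>
  define f where "f x = Complex (g x) (- g (\<i> *\<^sub>C x))" for x
  have f_add: "f (x + y) = f x + f y" for x y
    by (simp add: f_def linear_add[OF g(1)] scaleC_add_right complex_eq_iff)
  have g_scale: "g (c *\<^sub>C x) = Re c * g x + Im c * g (\<i> *\<^sub>C x)" for c x
  proof -
    have "c *\<^sub>C x = Re c *\<^sub>R x + Im c *\<^sub>R (\<i> *\<^sub>C x)"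
      by (simp add: scaleR_scaleC scaleC_add_left[symmetric] complex_eq mult.commute)
    then show ?thesis
      by (simp add: linear_add[OF g(1)] linear_scale[OF g(1)])
  qed
  have f_scale: "f (c *\<^sub>C x) = c * f x" for c x
    using g_scale[of c x] g_scale[of "\<i> * c" x] by (simp add: f_def complex_eq_iff)
  have f_p: "cmod (f x) \<le> 2 * p x" for x
    using g_p[of x] g_p[of "\<i> *\<^sub>C x"] cmod_le[of "f x"]
    by (simp add: f_def cont_seminorm_scale[OF p])
  have "continuous_on UNIV f"
  proof (clarsimp simp: continuous_on_eq_continuous_at isCont_def tendsto_at_iff_tendsto_nhds)
    fix x
    have "((\<lambda>y. 2 * p (y - x)) \<longlongrightarrow> 2 * 0) (nhds x)"
      using p tendsto_iff_cont_seminorm[of "\<lambda>y. y" x "nhds x"]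
      by (intro tendsto_mult tendsto_const) (auto simp: filterlim_ident)
    then have lim: "((\<lambda>y. 2 * p (y - x)) \<longlongrightarrow> 0) (nhds x)" by simp
    have "f y - f x = f (y - x)" for y
      using f_add[of "y - x" x] by simp
    then have "((\<lambda>y. f y - f x) \<longlongrightarrow> 0) (nhds x)"
      using f_p by (intro Lim_null_comparison[OF _ lim] always_eventually) auto
    then show "(f \<longlongrightarrow> f x) (nhds x)" by (simp add: LIM_zero_iff)
  qed
  then have "f \<in> dual_space"
    by (simp add: dual_space_iff f_add f_scale)
  moreover have "f r = 0" if "r \<in> R" for r
    using g_R[OF that] g_R[OF cvs.subspace_scale[OF R that]] by (simp add: f_def complex_eq_iff)
  ultimately have "f z = 0" by (rule ann)
  then have "q z = 0" by (simp add: f_def complex_eq_iff g(3))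
  moreover have "e \<le> q z" by (rule le_q) (rule far)
  ultimately show False using e by simp
qed

corollary dual_separates_points:
  fixes x y :: "'a::complex_lcs"
  assumes "\<And>f. f \<in> dual_space \<Longrightarrow> f x = f y"
  shows "x = y"
proof -
  have "x - y = 0"
  proof (rule eq_zero_if_cont_seminorms_zero)
    fix p :: "'a \<Rightarrow> real"
    assume p: "cont_seminorm p"
    have small: "p (x - y) < e" if "e > 0" for e
      using approximable_if_annihilated[OF _ p that, of "{0}" "x - y"] assms
      by (auto simp: dual_diff)
    show "p (x - y) = 0"
      using small[of "p (x - y)"] cont_seminorm_nonneg[OF p, of "x - y"] by fastforce
  qed
  then show ?thesis by simp
qed


section \<open>Weak cluster points in semi-reflexive spaces\<close>

text \<open>
  Tychonoff's theorem gives a cluster point of the sequence in the product of closed discs. The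
  filter \<open>G\<close> consists of the tails cut down to the neighbourhoods of that point, and plays the
  part of a convergent subnet.
\<close>

lemma compact_pointwise_cluster:
  fixes Y :: "nat \<Rightarrow> 'f \<Rightarrow> complex"
  assumes bound: "\<And>n f. cmod (Y n f) \<le> M f"
  shows "\<exists>G \<phi>. G \<noteq> bot \<and> G \<le> sequentially \<and> (\<forall>f. ((\<lambda>n. Y n f) \<longlongrightarrow> \<phi> f) G)"
proof -
  define K where "K = PiE UNIV (\<lambda>f. cball (0::complex) (M f))"
  have "compactin (product_topology (\<lambda>_. euclidean) UNIV) K"
    unfolding K_def by (simp add: compactin_PiE)
  then have "compact K"
    by (simp add: euclidean_product_topology)
  moreover have "filtermap Y sequentially \<noteq> bot"
    by (simp add: filtermap_bot_iff)
  moreover have "eventually (\<lambda>x. x \<in> K) (filtermap Y sequentially)"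
    using bound by (auto simp: eventually_filtermap K_def intro!: always_eventually)
  ultimately obtain \<phi> where \<phi>: "inf (nhds \<phi>) (filtermap Y sequentially) \<noteq> bot"
    unfolding compact_filter by blast
  define G where "G = inf (filtercomap Y (nhds \<phi>)) sequentially"
  have "G \<noteq> bot"
  proof
    assume "G = bot"
    then have "eventually (\<lambda>_. False) (inf (filtercomap Y (nhds \<phi>)) sequentially)"
      by (simp add: G_def)
    then obtain P R where P: "eventually P (nhds \<phi>)" and R: "eventually R sequentially"
        and "\<And>n. R n \<Longrightarrow> \<not> P (Y n)"
      unfolding eventually_inf eventually_filtercomap by blast
    with R have "eventually (\<lambda>x. \<not> P x) (filtermap Y sequentially)"
      unfolding eventually_filtermap by (auto elim: eventually_mono)
    with P have "eventually (\<lambda>_. False) (inf (nhds \<phi>) (filtermap Y sequentially))"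
      unfolding eventually_inf by blast
    with \<phi> show False by (simp add: trivial_limit_def)
  qed
  moreover have "filterlim Y (nhds \<phi>) G"
    unfolding G_def by (rule filterlim_mono[OF filterlim_filtercomap order_refl inf_le1])
  then have "((\<lambda>n. Y n f) \<longlongrightarrow> \<phi> f) G" for f
    by (rule continuous_on_UNIV_tendsto[OF continuous_on_product_coordinates])
  ultimately show ?thesis
    unfolding G_def by (meson inf_le2)
qed

lemma lcs_bounded_if_cont_seminorms_bounded:
  fixes S :: "'a::complex_lcs set"
  assumes "\<And>p. cont_seminorm p \<Longrightarrow> \<exists>K. \<forall>x\<in>S. p x \<le> K"
  shows "lcs_bounded S"
  unfolding lcs_bounded_def absorbs_def
proof (intro allI impI)
  fix U :: "'a set" assume "open U \<and> 0 \<in> U"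
  then obtain p where p: "cont_seminorm p" "\<And>x. p x < 1 \<Longrightarrow> x \<in> U"
    using cont_seminorm_ball_subset[of U] by blast
  obtain K where K: "\<And>x. x \<in> S \<Longrightarrow> p x \<le> K"
    using assms[OF p(1)] by blast
  have "S \<subseteq> (\<lambda>x. c *\<^sub>C x) ` U" if c: "\<bar>K\<bar> + 1 \<le> cmod c" for c
  proof
    fix x assume x: "x \<in> S"
    have c0: "c \<noteq> 0" using c by auto
    have "p x < cmod c" using K[OF x] c by simp
    then have "p ((1 / c) *\<^sub>C x) < 1"
      using c0 by (simp add: cont_seminorm_scale[OF p(1)] norm_divide field_simps)
    then have "(1 / c) *\<^sub>C x \<in> U" by (rule p(2))
    moreover have "x = c *\<^sub>C ((1 / c) *\<^sub>C x)" using c0 by simp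
    ultimately show "x \<in> (\<lambda>x. c *\<^sub>C x) ` U" by blast
  qed
  then show "\<exists>r>0. \<forall>c. r \<le> cmod c \<longrightarrow> S \<subseteq> (\<lambda>x. c *\<^sub>C x) ` U"
    by (intro exI[of _ "\<bar>K\<bar> + 1"]) auto
qed

lemma topspace_strong_dual_topology: "topspace strong_dual_topology = dual_space"
proof (rule antisym)
  show "topspace strong_dual_topology \<subseteq> dual_space"
    using openin_topspace[of strong_dual_topology] openin_strong_dual_topology by blast
  have "lcs_bounded ({} :: 'a set)"
    by (rule lcs_bounded_if_cont_seminorms_bounded) simp
  then have "openin strong_dual_topology (dual_space :: ('a \<Rightarrow> complex) set)"
    unfolding openin_strong_dual_topology by (auto intro!: exI[of _ "{}"] exI[of _ 1])
  then show "(dual_space :: ('a \<Rightarrow> complex) set) \<subseteq> topspace strong_dual_topology"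
    by (rule openin_subset)
qed

text \<open>
  The limit of \<open>f (y n)\<close> along a fixed filter is linear in \<open>f\<close>, and it is strongly continuous
  because its modulus is at most the supremum of the modulus of \<open>f\<close> over the bounded set of all
  \<open>y n\<close>. Semi-reflexivity represents it by a point.
\<close>

lemma semi_reflexive_weak_cluster_point:
  fixes y :: "nat \<Rightarrow> 'a::complex_lcs"
  assumes refl: "semi_reflexive TYPE('a)"
    and bdd: "\<And>p. cont_seminorm p \<Longrightarrow> \<exists>K. \<forall>n. p (y n) \<le> K"
  shows "\<exists>G l. G \<noteq> bot \<and> G \<le> sequentially \<and> (\<forall>f\<in>dual_space. ((\<lambda>n. f (y n)) \<longlongrightarrow> f l) G)"
proof -
  have "\<exists>K. \<forall>n. cmod (f (y n)) \<le> K" if "f \<in> dual_space" for f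
    using bdd[OF cont_seminorm_dual[OF that]] .
  then obtain M where M: "\<And>f n. f \<in> dual_space \<Longrightarrow> cmod (f (y n)) \<le> M f"
    by metis
  define Y where "Y n f = (if f \<in> dual_space then f (y n) else 0)" for n f
  have bound: "cmod (Y n f) \<le> (if f \<in> dual_space then M f else 0)" for n f
    using M by (simp add: Y_def)
  obtain G \<phi> where G: "G \<noteq> bot" "G \<le> sequentially"
      and all: "\<And>f. ((\<lambda>n. Y n f) \<longlongrightarrow> \<phi> f) G"
    using compact_pointwise_cluster[of Y, OF bound] by blast
  have lim: "((\<lambda>n. f (y n)) \<longlongrightarrow> \<phi> f) G" if "f \<in> dual_space" for f
    using all[of f] that by (simp add: Y_def)
  have "bidual_functional \<phi>"
    unfolding bidual_functional_def
  proof (intro conjI ballI allI)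
    fix f g :: "'a \<Rightarrow> complex"
    assume f: "f \<in> dual_space" and g: "g \<in> dual_space"
    have "(\<lambda>x. f x + g x) \<in> dual_space"
      using f g by (auto simp: dual_space_iff algebra_simps intro!: continuous_on_add)
    from tendsto_unique[OF G(1) lim[OF this] tendsto_add[OF lim[OF f] lim[OF g]]]
    show "\<phi> (\<lambda>x. f x + g x) = \<phi> f + \<phi> g" .
  next
    fix c and f :: "'a \<Rightarrow> complex"
    assume f: "f \<in> dual_space"
    have "(\<lambda>x. c * f x) \<in> dual_space"
      using f by (auto simp: dual_space_iff algebra_simps intro!: continuous_on_mult_left)
    from tendsto_unique[OF G(1) lim[OF this] tendsto_mult_left[OF lim[OF f]]]
    show "\<phi> (\<lambda>x. c * f x) = c * \<phi> f" .
  next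
    have S: "lcs_bounded (range y)"
      by (rule lcs_bounded_if_cont_seminorms_bounded) (use bdd in auto)
    show "continuous_map strong_dual_topology euclidean \<phi>"
      unfolding continuous_map_def topspace_strong_dual_topology
    proof (intro conjI allI impI)
      fix U :: "complex set" assume "openin euclidean U"
      then have U: "open U" by simp
      show "openin strong_dual_topology {f \<in> dual_space. \<phi> f \<in> U}"
        unfolding openin_strong_dual_topology
      proof (intro conjI ballI)
        fix f assume "f \<in> {f \<in> dual_space. \<phi> f \<in> U}"
        then have f: "f \<in> dual_space" "\<phi> f \<in> U" by auto
        obtain e where e: "e > 0" "cball (\<phi> f) e \<subseteq> U"
          using U f(2) open_contains_cball by blast
        have "\<phi> g \<in> U" if g: "g \<in> dual_space" "\<forall>x\<in>range y. cmod (g x - f x) < e" for g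
        proof -
          have "((\<lambda>n. cmod (g (y n) - f (y n))) \<longlongrightarrow> cmod (\<phi> g - \<phi> f)) G"
            by (intro tendsto_norm tendsto_diff lim g f)
          then have "cmod (\<phi> g - \<phi> f) \<le> e"
            by (rule tendsto_upperbound)
              (use g(2) G(1) in \<open>auto intro!: always_eventually less_imp_le\<close>)
          then have "\<phi> g \<in> cball (\<phi> f) e" by (simp add: dist_norm norm_minus_commute)
          with e(2) show ?thesis by blast
        qed
        with S e(1) show "\<exists>S e. lcs_bounded S \<and> e > 0 \<and>
            {g \<in> dual_space. \<forall>x\<in>S. cmod (g x - f x) < e} \<subseteq> {f \<in> dual_space. \<phi> f \<in> U}"
          by (intro exI[of _ "range y"] exI[of _ e]) blast
      qed auto
    qed auto
  qed
  then obtain l where "\<And>f. f \<in> dual_space \<Longrightarrow> \<phi> f = f l"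
    using refl unfolding semi_reflexive_def by blast
  with lim G show ?thesis by metis
qed


section \<open>Matrix means\<close>

lemma lcs_operator_iff:
  "lcs_operator T \<longleftrightarrow> (\<forall>x y. T (x + y) = T x + T y) \<and> (\<forall>c x. T (c *\<^sub>C x) = c *\<^sub>C T x) \<and>
     continuous_on UNIV T"
  by (simp add: lcs_operator_def Vector_Spaces.linear_iff vector_space_scaleC)

lemma
  assumes "lcs_operator T"
  shows operator_add: "T (x + y) = T x + T y"
    and operator_scale: "T (c *\<^sub>C x) = c *\<^sub>C T x"
    and operator_continuous: "continuous_on UNIV T"
  using assms by (auto simp: lcs_operator_iff)

lemma operator_zero: "lcs_operator T \<Longrightarrow> T 0 = 0"
  using operator_scale[of T 0 0] by simp

lemma operator_diff: "lcs_operator T \<Longrightarrow> T (x - y) = T x - T y"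
  using operator_add[of T "x - y" y] by simp

lemma operator_sum: "lcs_operator T \<Longrightarrow> T (\<Sum>i\<in>I. g i) = (\<Sum>i\<in>I. T (g i))"
  by (induction I rule: infinite_finite_induct) (simp_all add: operator_zero operator_add)

lemma operator_funpow:
  assumes T: "lcs_operator T"
  shows "lcs_operator (T ^^ i)"
proof (induction i)
  case 0
  then show ?case by (simp add: lcs_operator_iff)
next
  case (Suc i)
  have "continuous_on UNIV (T \<circ> (T ^^ i))"
    using operator_continuous[OF Suc] operator_continuous[OF T]
    by (intro continuous_on_compose) (auto intro: continuous_on_subset)
  then show ?case
    by (simp add: lcs_operator_iff operator_add[OF Suc] operator_add[OF T]
        operator_scale[OF Suc] operator_scale[OF T])
qed

lemma cont_seminorm_operator:
  assumes T: "lcs_operator T" and p: "cont_seminorm p"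
  shows "cont_seminorm (\<lambda>x. p (T x))"
  using continuous_on_compose2[OF cont_seminorm_continuous[OF p] operator_continuous[OF T]]
  by (auto simp: cont_seminorm_def operator_add[OF T] operator_scale[OF T]
      cont_seminorm_nonneg[OF p] cont_seminorm_add[OF p] cont_seminorm_scale[OF p])

lemma dual_operator:
  assumes T: "lcs_operator T" and f: "f \<in> dual_space"
  shows "(\<lambda>x. f (T x)) \<in> dual_space"
  using continuous_on_compose2[OF dual_continuous[OF f] operator_continuous[OF T]]
  by (auto simp: dual_space_iff operator_add[OF T] operator_scale[OF T] dual_add[OF f]
      dual_scale[OF f])

lemma
  assumes T: "lcs_operator T"
  shows matrix_mean_add: "matrix_mean A T n (x + y) = matrix_mean A T n x + matrix_mean A T n y"
    and matrix_mean_diff: "matrix_mean A T n (x - y) = matrix_mean A T n x - matrix_mean A T n y"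
    and matrix_mean_scale: "matrix_mean A T n (c *\<^sub>C x) = c *\<^sub>C matrix_mean A T n x"
    and matrix_mean_commute: "matrix_mean A T n (T x) = T (matrix_mean A T n x)"
  by (simp_all add: matrix_mean_def operator_add[OF operator_funpow[OF T]]
      operator_diff[OF operator_funpow[OF T]] operator_scale[OF operator_funpow[OF T]]
      operator_sum[OF T] operator_scale[OF T] funpow_swap1 scaleC_add_right sum.distrib
      cvs.scale_right_diff_distrib sum_subtractf cvs.scale_sum_right mult.commute)

lemma matrix_mean_fixed_point:
  assumes "T x = x" and "(\<Sum>i\<le>n. A n i) = 1"
  shows "matrix_mean A T n x = x"
proof -
  have "(T ^^ i) x = x" for i
    by (induction i) (simp_all add: assms(1))
  then show ?thesis
    using assms(2) by (simp add: matrix_mean_def cvs.scale_sum_left[symmetric])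
qed

lemma dual_matrix_mean:
  assumes f: "f \<in> dual_space" and inv: "\<And>x. f (T x) = f x" and "(\<Sum>i\<le>n. A n i) = 1"
  shows "f (matrix_mean A T n x) = f x"
proof -
  have "f ((T ^^ i) x) = f x" for i
    by (induction i) (simp_all add: inv)
  then show ?thesis
    using assms(3) by (simp add: matrix_mean_def dual_sum[OF f] dual_scale[OF f]
        sum_distrib_right[symmetric])
qed

lemma matrix_prod_lower_triangular:
  assumes "lower_triangular C"
  shows "matrix_prod C A n k = (\<Sum>i\<le>n. C n i * A i k)"
  unfolding matrix_prod_def
  by (rule suminf_finite) (use assms in \<open>auto simp: lower_triangular_def\<close>)

lemma suminf_lower_triangular:
  assumes "lower_triangular C"
  shows "(\<Sum>i. cmod (C n i)) = (\<Sum>i\<le>n. cmod (C n i))"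
  by (rule suminf_finite) (use assms in \<open>auto simp: lower_triangular_def\<close>)

lemma matrix_mean_prod:
  assumes C: "lower_triangular C" and A: "lower_triangular A"
  shows "matrix_mean (matrix_prod C A) T n x = (\<Sum>i\<le>n. C n i *\<^sub>C matrix_mean A T i x)"
proof -
  have row: "matrix_mean A T i x = (\<Sum>k\<le>n. A i k *\<^sub>C (T ^^ k) x)" if "i \<le> n" for i
    unfolding matrix_mean_def
    by (rule sum.mono_neutral_left) (use A that in \<open>auto simp: lower_triangular_def\<close>)
  have "matrix_mean (matrix_prod C A) T n x = (\<Sum>k\<le>n. \<Sum>i\<le>n. C n i *\<^sub>C A i k *\<^sub>C (T ^^ k) x)"
    by (simp add: matrix_mean_def matrix_prod_lower_triangular[OF C] cvs.scale_sum_left)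
  also have "\<dots> = (\<Sum>i\<le>n. C n i *\<^sub>C (\<Sum>k\<le>n. A i k *\<^sub>C (T ^^ k) x))"
    by (subst sum.swap) (simp add: cvs.scale_sum_right)
  also have "\<dots> = (\<Sum>i\<le>n. C n i *\<^sub>C matrix_mean A T i x)"
    by (rule sum.cong) (simp_all add: row)
  finally show ?thesis .
qed

lemma matrix_mean_prod_le:
  assumes C: "lower_triangular C" and A: "lower_triangular A" and p: "cont_seminorm p"
    and bound: "\<And>i. p (matrix_mean A T i x) \<le> K"
  shows "p (matrix_mean (matrix_prod C A) T n x) \<le> (\<Sum>i. cmod (C n i)) * K"
proof -
  have "p (matrix_mean (matrix_prod C A) T n x) \<le> (\<Sum>i\<le>n. p (C n i *\<^sub>C matrix_mean A T i x))"
    unfolding matrix_mean_prod[OF C A] by (rule cont_seminorm_sum[OF p])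
  also have "\<dots> \<le> (\<Sum>i\<le>n. cmod (C n i) * K)"
    by (intro sum_mono) (simp add: cont_seminorm_scale[OF p] bound mult_left_mono)
  finally show ?thesis
    by (simp add: suminf_lower_triangular[OF C] sum_distrib_right)
qed

text \<open>
  Summation by parts: the differences of consecutive coefficients of \<open>B\<close> are moved onto the powers
  of \<open>T\<close>, which leaves the term of index \<open>0\<close> at the boundary. The extra \<open>T\<close> on the left aligns
  the powers, so that the shifted sum is a full \<open>B\<close>-mean again.
\<close>

lemma operator_matrix_mean_Delta:
  assumes B: "lower_triangular B" and T: "lcs_operator T"
  shows "T (matrix_mean (matrix_prod B Delta) T n x) =
    T (matrix_mean B T n x) - matrix_mean B T n x + B n 0 *\<^sub>C x"
proof -
  have entry: "matrix_prod B Delta n k = B n k - B n (Suc k)" if "k \<le> n" for k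
  proof -
    have "matrix_prod B Delta n k =
        (\<Sum>i\<le>n. (if i = k then B n i else 0) - (if i = Suc k then B n i else 0))"
      unfolding matrix_prod_lower_triangular[OF B]
      by (rule sum.cong) (auto simp: Delta_def)
    also have "\<dots> = B n k - B n (Suc k)"
      using that B by (auto simp: sum_subtractf lower_triangular_def)
    finally show ?thesis .
  qed
  have "T (matrix_mean (matrix_prod B Delta) T n x) =
      (\<Sum>k\<le>n. B n k *\<^sub>C (T ^^ Suc k) x) - (\<Sum>k\<le>n. B n (Suc k) *\<^sub>C (T ^^ Suc k) x)"
    by (simp add: matrix_mean_def entry operator_sum[OF T] operator_scale[OF T] operator_diff[OF T]
        cvs.scale_left_diff_distrib sum_subtractf)
  also have "(\<Sum>k\<le>n. B n k *\<^sub>C (T ^^ Suc k) x) = T (matrix_mean B T n x)"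
    by (simp add: matrix_mean_def operator_sum[OF T] operator_scale[OF T])
  also have "(\<Sum>k\<le>n. B n (Suc k) *\<^sub>C (T ^^ Suc k) x) = matrix_mean B T n x - B n 0 *\<^sub>C x"
  proof -
    have "(\<Sum>k\<le>Suc n. B n k *\<^sub>C (T ^^ k) x) = matrix_mean B T n x"
      using B by (simp add: matrix_mean_def lower_triangular_def)
    then show ?thesis
      by (subst (asm) sum.atMost_Suc_shift) (simp add: algebra_simps)
  qed
  finally show ?thesis by simp
qed


section \<open>The mean ergodic theorem\<close>

text \<open>
  Boundedness enters three times: it supplies the weak cluster point, it extends the convergence
  of the means to zero from the vectors \<open>w - T w\<close> to everything that they approximate, and it
  makes the limit operator continuous.
\<close>

theorem mean_ergodic:
  fixes T :: "'a::complex_lcs \<Rightarrow> 'a"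
  assumes refl: "semi_reflexive TYPE('a)" and T: "lcs_operator T"
    and row: "\<And>n. (\<Sum>i\<le>n. B n i) = 1"
    and bdd: "matrix_bounded B T"
    and inv: "\<And>x. (\<lambda>n. T (matrix_mean B T n x) - matrix_mean B T n x) \<longlonglongrightarrow> 0"
  shows "matrix_ergodic B T"
proof -
  let ?m = "matrix_mean B T"
  have eq: "\<exists>q. cont_seminorm q \<and> (\<forall>x n. p (?m n x) \<le> q x)" if "cont_seminorm p" for p
    using bdd that by (simp add: matrix_bounded_def)
  have conv: "\<exists>y. (\<lambda>n. ?m n x) \<longlonglongrightarrow> y" for x
  proof -
    have "\<exists>K. \<forall>n. p (?m n x) \<le> K" if "cont_seminorm p" for p
      using eq[OF that] by blast
    then obtain G y where G: "G \<noteq> bot" "G \<le> sequentially"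
        and lim: "\<And>f. f \<in> dual_space \<Longrightarrow> ((\<lambda>n. f (?m n x)) \<longlongrightarrow> f y) G"
      using semi_reflexive_weak_cluster_point[OF refl, of "\<lambda>n. ?m n x"] by blast
    have fixed: "T y = y"
    proof (rule dual_separates_points)
      fix f :: "'a \<Rightarrow> complex" assume f: "f \<in> dual_space"
      have "(\<lambda>n. f (T (?m n x) - ?m n x)) \<longlonglongrightarrow> f 0"
        by (rule continuous_on_UNIV_tendsto[OF dual_continuous[OF f] inv])
      then have "((\<lambda>n. f (T (?m n x)) - f (?m n x)) \<longlongrightarrow> 0) G"
        using tendsto_mono[OF G(2)] by (simp add: dual_diff[OF f] dual_zero[OF f])
      moreover have "((\<lambda>n. f (T (?m n x)) - f (?m n x)) \<longlongrightarrow> f (T y) - f y) G"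
        by (intro tendsto_diff lim[OF f] lim[OF dual_operator[OF T f]])
      ultimately have "f (T y) - f y = 0"
        using tendsto_unique[OF G(1)] by blast
      then show "f (T y) = f y" by simp
    qed
    have fixed_mean: "?m n y = y" for n
      using fixed row by (rule matrix_mean_fixed_point)
    define R where "R = range (\<lambda>w. w - T w)"
    have "cvs.subspace R"
    proof (rule cvs.subspaceI)
      have "0 = 0 - T 0" by (simp add: operator_zero[OF T])
      then show "0 \<in> R" unfolding R_def by (rule range_eqI)
    next
      fix u v assume "u \<in> R" "v \<in> R"
      then obtain a b where "u = a - T a" "v = b - T b" by (auto simp: R_def)
      then have "u + v = (a + b) - T (a + b)" by (simp add: operator_add[OF T])
      then show "u + v \<in> R" unfolding R_def by (rule range_eqI)
    next
      fix c u assume "u \<in> R"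
      then obtain a where "u = a - T a" by (auto simp: R_def)
      then have "c *\<^sub>C u = c *\<^sub>C a - T (c *\<^sub>C a)"
        by (simp add: operator_scale[OF T] cvs.scale_right_diff_distrib)
      then show "c *\<^sub>C u \<in> R" unfolding R_def by (rule range_eqI)
    qed
    \<comment> \<open>functionals vanishing on \<open>R\<close> are \<open>T\<close>-invariant, so they agree at \<open>x\<close> and its means\<close>
    moreover have "f (x - y) = 0" if f: "f \<in> dual_space" and fR: "\<And>r. r \<in> R \<Longrightarrow> f r = 0" for f
    proof -
      have "f (w - T w) = 0" for w by (rule fR) (simp add: R_def)
      then have "f (T w) = f w" for w by (simp add: dual_diff[OF f])
      then have "f (?m n x) = f x" for n by (rule dual_matrix_mean[OF f _ row])
      then have "((\<lambda>n. f x) \<longlongrightarrow> f y) G" using lim[OF f] by simp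
      then have "f x = f y" by (rule tendsto_unique[OF G(1) tendsto_const])
      then show ?thesis by (simp add: dual_diff[OF f])
    qed
    ultimately have approx: "\<exists>r\<in>R. q (x - y - r) < e" if "cont_seminorm q" "e > 0" for q e
      by (rule approximable_if_annihilated[OF _ that])
    have "(\<lambda>n. ?m n x) \<longlonglongrightarrow> y"
      unfolding tendsto_iff_cont_seminorm
    proof (intro allI impI tendstoI)
      fix p :: "'a \<Rightarrow> real" and e :: real
      assume p: "cont_seminorm p" and e: "e > 0"
      obtain q where q: "cont_seminorm q" "\<And>x n. p (?m n x) \<le> q x"
        using eq[OF p] by blast
      have e2: "e / 2 > 0" using e by simp
      obtain w where w: "q (x - y - (w - T w)) < e / 2"
        using approx[OF q(1) e2] by (auto simp: R_def)
      have "(\<lambda>n. p (T (?m n w) - ?m n w)) \<longlonglongrightarrow> 0"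
        using inv[of w] p unfolding tendsto_iff_cont_seminorm by simp
      then have "eventually (\<lambda>n. p (T (?m n w) - ?m n w) < e / 2) sequentially"
        by (rule order_tendstoD) (rule e2)
      then show "eventually (\<lambda>n. dist (p (?m n x - y)) 0 < e) sequentially"
      proof (rule eventually_mono)
        fix n assume n: "p (T (?m n w) - ?m n w) < e / 2"
        have "?m n x - y = ?m n (x - y - (w - T w)) - (T (?m n w) - ?m n w)"
          by (simp add: matrix_mean_diff[OF T] matrix_mean_commute[OF T]
              fixed_mean)
        then have "p (?m n x - y) \<le> p (?m n (x - y - (w - T w))) + p (T (?m n w) - ?m n w)"
          using cont_seminorm_diff[OF p] by simp
        also have "\<dots> < e"
          using q(2)[of n "x - y - (w - T w)"] w n by simp
        finally show "dist (p (?m n x - y)) 0 < e"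
          using cont_seminorm_nonneg[OF p, of "?m n x - y"] by simp
      qed
    qed
    then show ?thesis by blast
  qed
  then obtain P where P: "\<And>x. (\<lambda>n. ?m n x) \<longlonglongrightarrow> P x"
    by metis
  have P_add: "P (x + y) = P x + P y" for x y
    using tendsto_unique[OF _ P[of "x + y"]] tendsto_add[OF P[of x] P[of y]]
    by (simp add: matrix_mean_add[OF T])
  have P_scale: "P (c *\<^sub>C x) = c *\<^sub>C P x" for c x
    using tendsto_unique[OF _ P[of "c *\<^sub>C x"]] tendsto_scaleC[OF tendsto_const P[of x], of c]
    by (simp add: matrix_mean_scale[OF T])
  have P_diff: "P x - P y = P (x - y)" for x y
    using P_add[of "x - y" y] by simp
  have "continuous_on UNIV P"
  proof (clarsimp simp: continuous_on_eq_continuous_at isCont_def tendsto_at_iff_tendsto_nhds)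
    fix x
    show "(P \<longlongrightarrow> P x) (nhds x)"
      unfolding tendsto_iff_cont_seminorm
    proof (intro allI impI)
      fix p :: "'a \<Rightarrow> real" assume p: "cont_seminorm p"
      obtain q where q: "cont_seminorm q" "\<And>x n. p (?m n x) \<le> q x"
        using eq[OF p] by blast
      have le: "p (P z) \<le> q z" for z
        by (rule tendsto_upperbound[OF continuous_on_UNIV_tendsto[OF cont_seminorm_continuous[OF p] P]])
          (simp_all add: q(2))
      have "((\<lambda>y. q (y - x)) \<longlongrightarrow> 0) (nhds x)"
        using q(1) tendsto_iff_cont_seminorm[of "\<lambda>y. y" x "nhds x"] by (simp add: filterlim_ident)
      then show "((\<lambda>y. p (P y - P x)) \<longlongrightarrow> 0) (nhds x)"
        by (rule Lim_null_comparison[rotated])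
          (use le cont_seminorm_nonneg[OF p] in \<open>simp add: P_diff\<close>)
    qed
  qed
  then have "lcs_operator P"
    by (simp add: lcs_operator_iff P_add P_scale)
  with P show ?thesis
    unfolding matrix_ergodic_def by blast
qed

theorem theorem4p10:
  fixes A B :: inf_matrix
    and T :: "'a::complex_lcs \<Rightarrow> 'a"
  assumes "probability_matrix A" and "probability_matrix B"
    and "(\<lambda>n. B n 0) \<longlonglongrightarrow> 0"
    and "star_C A B"
    and "star_3C A (matrix_prod B Delta)"
    and "reflexive_space TYPE('a)"
    and "lcs_operator T" and "matrix_bounded A T"
  shows "matrix_ergodic B T"
proof (rule mean_ergodic)
  have A: "lower_triangular A" and B: "lower_triangular B"
    using assms(1,2) by (auto simp: probability_matrix_def)
  note T = \<open>lcs_operator T\<close>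
  have bdd: "\<exists>q. cont_seminorm q \<and> (\<forall>x n. p (matrix_mean A T n x) \<le> q x)"
    if "cont_seminorm p" for p
    using assms(8) that by (simp add: matrix_bounded_def)
  show "semi_reflexive TYPE('a)"
    using assms(6) by (simp add: reflexive_space_def)
  show "lcs_operator T" by (rule T)
  show "(\<Sum>i\<le>n. B n i) = 1" for n
    using assms(2) by (simp add: probability_matrix_def)
  show "matrix_bounded B T"
    unfolding matrix_bounded_def
  proof (intro allI impI)
    fix p :: "'a \<Rightarrow> real" assume p: "cont_seminorm p"
    obtain C M where C: "lower_triangular C" "matrix_prod C A = B"
        and M: "\<And>n. (\<Sum>i. cmod (C n i)) \<le> M"
      using assms(4) by (auto simp: star_C_def bdd_above_def)
    obtain q where q: "cont_seminorm q" "\<And>x n. p (matrix_mean A T n x) \<le> q x"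
      using bdd[OF p] by blast
    have M0: "0 \<le> M"
      using M[of 0] suminf_lower_triangular[OF C(1), of 0] order_trans[OF norm_ge_zero] by auto
    have "p (matrix_mean B T n x) \<le> M * q x" for n x
    proof -
      have "p (matrix_mean B T n x) \<le> (\<Sum>i. cmod (C n i)) * q x"
        using matrix_mean_prod_le[OF C(1) A p q(2)] C(2) by simp
      also have "\<dots> \<le> M * q x"
        by (intro mult_right_mono M cont_seminorm_nonneg[OF q(1)])
      finally show ?thesis .
    qed
    moreover have "cont_seminorm (\<lambda>x. M * q x)"
      by (rule cont_seminorm_mult[OF q(1) M0])
    ultimately show "\<exists>q. cont_seminorm q \<and> (\<forall>x n. p (matrix_mean B T n x) \<le> q x)"
      by blast
  qed
  show "(\<lambda>n. T (matrix_mean B T n x) - matrix_mean B T n x) \<longlonglongrightarrow> 0" for x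
  proof -
    obtain D where D: "lower_triangular D" "matrix_prod D A = matrix_prod B Delta"
        and D0: "(\<lambda>n. \<Sum>i. cmod (D n i)) \<longlonglongrightarrow> 0"
      using assms(5) by (auto simp: star_3C_def)
    have "(\<lambda>n. T (matrix_mean (matrix_prod B Delta) T n x)) \<longlonglongrightarrow> 0"
      unfolding tendsto_iff_cont_seminorm
    proof (intro allI impI)
      fix p :: "'a \<Rightarrow> real" assume p: "cont_seminorm p"
      \<comment> \<open>estimating with the seminorm \<open>p \<circ> T\<close> absorbs the outer \<open>T\<close>\<close>
      have pT: "cont_seminorm (\<lambda>x. p (T x))" by (rule cont_seminorm_operator[OF T p])
      obtain q where q: "\<And>x n. p (T (matrix_mean A T n x)) \<le> q x"
        using bdd[OF pT] by blast
      have le: "p (T (matrix_mean (matrix_prod B Delta) T n x)) \<le> (\<Sum>i. cmod (D n i)) * q x" for n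
        using matrix_mean_prod_le[OF D(1) A pT q] D(2) by simp
      have "(\<lambda>n. (\<Sum>i. cmod (D n i)) * q x) \<longlonglongrightarrow> 0"
        using tendsto_mult_right[OF D0, of "q x"] by simp
      then show "(\<lambda>n. p (T (matrix_mean (matrix_prod B Delta) T n x) - 0)) \<longlonglongrightarrow> 0"
        by (rule Lim_null_comparison[rotated]) (simp add: cont_seminorm_nonneg[OF p] le)
    qed
    from tendsto_diff[OF this tendsto_scaleC[OF assms(3) tendsto_const[of x]]]
    show ?thesis
      by (simp add: operator_matrix_mean_Delta[OF B T])
  qed
qed

end
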